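(* Let $\boldsymbol T$ be a uniform random element of $\mathcal T_n$. Then $\mathbb P(\beta(\boldsymbol T)\geqslant\log^4 n)=e^{-\omega(\log n)}$, i.e. $n^{c}\,\mathbb P(\beta(\boldsymbol T)\geqslant\log^4 n)\to0$ as $n\to\infty$ for every constant $c$.
   Context: $\mathcal T_n$ is the set of trees with vertex set $[n]$; $d_T(i,j)$ is the graph distance in $T$. For $T\in\mathcal T_n$, $\beta(T)=\max_{i,d\in[n]}\frac{|\{j\in[n]: d_T(i,j)=d\}|}{d}$. *)

theory Defs
  imports "HOL-Probability.Probability" "Graph_Theory.Graph_Theory"
begin

text \<open>
  A finite simple graph is a symmetric loop-free digraph without parallel arcs, i.e. a
  \<^const>\<open>pair_graph\<close>: the edge \<open>{u, v}\<close> is the pair of arcs \<open>(u, v)\<close>, \<open>(v, u)\<close>.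
  The digraph notion \<^const>\<open>Digraph_Component.tree\<close> is unsuitable here, because
  \<^const>\<open>pre_digraph.cycle\<close> counts \<open>u, v, u\<close> as a cycle. For a symmetric loop-free digraph
  the cycles of the undirected graph are exactly the directed cycles of length at least 3.
\<close>

definition undirected_tree :: "'a pair_pre_digraph \<Rightarrow> bool" where
  "undirected_tree T \<longleftrightarrow>
     pair_graph T \<and> Digraph_Component.connected (with_proj T) \<and>
     \<not> (\<exists>p. pre_digraph.cycle (with_proj T) p \<and> length p \<ge> 3)"

definition labelled_trees :: "nat \<Rightarrow> nat pair_pre_digraph set" where
  "labelled_trees n = {T. pverts T = {1..n} \<and> undirected_tree T}"

text \<open>\<^const>\<open>wf_digraph.\<mu>\<close> is the infimum of the weights of all walks; with unit weights this
  is the graph distance (\<open>\<infinity>\<close> between different components).\<close>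

definition graph_dist :: "'a pair_pre_digraph \<Rightarrow> 'a \<Rightarrow> 'a \<Rightarrow> ereal" where
  "graph_dist T = wf_digraph.\<mu> (with_proj T) (\<lambda>_. 1)"

definition beta :: "'a pair_pre_digraph \<Rightarrow> real" where
  "beta T = Max {real (card {j \<in> pverts T. graph_dist T i j = ereal (real d)}) / real d | i d.
                   i \<in> pverts T \<and> d \<in> {1..card (pverts T)}}"

text \<open>\<^const>\<open>pmf_of_set\<close> is the uniform distribution only on finite nonempty sets.\<close>

lemma finite_labelled_trees: "finite (labelled_trees n)"
proof (rule finite_subset)
  show "labelled_trees n \<subseteq>
      (\<lambda>A. \<lparr>pverts = {1..n}, parcs = A\<rparr>) ` Pow ({1..n} \<times> {1..n})"
  proof
    fix T assume T: "T \<in> labelled_trees n"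
    then interpret pair_graph T by (simp add: labelled_trees_def undirected_tree_def)
    have "parcs T \<subseteq> {1..n} \<times> {1..n}"
      using T in_arcsD1 in_arcsD2 by (fastforce simp: labelled_trees_def)
    moreover have "T = \<lparr>pverts = {1..n}, parcs = parcs T\<rparr>"
      using T by (cases T) (simp add: labelled_trees_def)
    ultimately show "T \<in> (\<lambda>A. \<lparr>pverts = {1..n}, parcs = A\<rparr>) ` Pow ({1..n} \<times> {1..n})"
      by blast
  qed
qed simp

lemma labelled_trees_nonempty:
  assumes "n \<ge> 1"
  shows "labelled_trees n \<noteq> {}"
proof -
  define A where "A = {1::nat} \<times> {2..n} \<union> {2..n} \<times> {1}"
  define T where "T = \<lparr>pverts = {1..n}, parcs = A\<rparr>"
  have [simp]: "pverts T = {1..n}" "parcs T = A" by (simp_all add: T_def)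
  interpret pair_graph T
  proof
    show "symmetric (with_proj T)"
      by (auto simp: symmetric_def sym_def A_def)
  qed (use assms in \<open>auto simp: A_def\<close>)
  have "u \<rightarrow>\<^sup>*\<^bsub>with_proj T\<^esub> v" if "u \<in> {1..n}" "v \<in> {1..n}" for u v
  proof -
    have to1: "w \<rightarrow>\<^sup>*\<^bsub>with_proj T\<^esub> 1" if "w \<in> {1..n}" for w
    proof (cases "w = 1")
      case True
      then show ?thesis using assms by (auto intro: reachable_refl)
    next
      case False
      then have "(w, 1) \<in> parcs T" using that by (auto simp: A_def)
      then show ?thesis by (intro reachable_adjI) simp
    qed
    have from1: "1 \<rightarrow>\<^sup>*\<^bsub>with_proj T\<^esub> w" if "w \<in> {1..n}" for w
      using to1[OF that] symmetric_reachable[OF pair_sym_arcs] by blast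
    show ?thesis using to1[OF that(1)] from1[OF that(2)] by (rule reachable_trans)
  qed
  then have "Digraph_Component.connected (with_proj T)"
    using assms reachable_mk_symmetric_eq[OF pair_sym_arcs]
    by (auto simp: Digraph_Component.connected_def strongly_connected_def mk_symmetric_def)
  moreover have False if c: "cycle p" and l: "length p \<ge> 3" for p
  proof -
    from c obtain u where u: "awalk u p u" "distinct (tl (pawalk_verts u p))"
      by (auto simp: cycle_def)
    obtain a b e q where p: "p = a # b # e # q"
      using l by (auto simp: numeral_3_eq_3 Suc_le_length_iff)
    have "x \<in> set (pawalk_verts x r)" if "pcas x r v" for x v :: nat and r
      using that by (cases r) auto
    then show False
      using u unfolding p by (cases q) (auto simp: awalk_def A_def)
  qed
  ultimately have "T \<in> labelled_trees n"
    using pair_graph_axioms by (auto simp: labelled_trees_def undirected_tree_def)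
  then show ?thesis by blast
qed

end

theory Submission
  imports Defs "HOL-Real_Asymp.Real_Asymp"
begin

text \<open>
  Rooting a tree at \<open>r\<close> and sending every other vertex to its neighbour closer to \<open>r\<close> embeds
  the trees into all functions \<open>V - {r} \<rightarrow> V\<close>. There are \<open>n ^ (n - 1)\<close> such functions and at
  least \<open>n ^ (n - 2)\<close> trees, so passing from a uniform tree to a uniform function costs only a
  factor \<open>n\<close>. Under a uniform function the sphere around \<open>r\<close> of radius \<open>t + 1\<close> is, given the
  smaller spheres, binomial with mean at most the size of the sphere of radius \<open>t\<close>. Its
  exponential moments therefore iterate as for a critical Poisson branching process: the parameter
  \<open>1 / (m + 1)\<close> at one level becomes at most \<open>1 / m\<close> at the previous one, because
  \<open>exp (1 / (m + 1)) - 1 \<le> 1 / m\<close>. Hence \<open>exp (Z\<^sub>d / (d + 1))\<close> has mean at most \<open>e\<close>, where \<open>Z\<^sub>d\<close> is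
  the size of the sphere of radius \<open>d\<close>, and Markov's inequality with a union bound over \<open>r\<close> and
  \<open>d\<close> shows that \<open>beta \<ge> K\<close> has probability at most \<open>n ^ 3 * exp (1 - K / 2)\<close>.
\<close>

section \<open>Functions decomposed along the preimage of the roots\<close>


text \<open>A function is determined by the preimage \<open>J\<close> of \<open>B\<close>, by
  arbitrary values in \<open>B\<close> on \<open>J\<close>, and by its restriction to
  \<open>A - J\<close>, which maps into \<open>(A - J) \<union> J\<close>. The restriction is the
  same kind of object with root set \<open>J\<close>, so this is the recursion behind both
  inductions below.\<close>

lemma sum_PiE_by_preimage:
  fixes \<phi> :: "('a \<Rightarrow> 'a) \<Rightarrow> 'b::comm_semiring_1"
  assumes fin: "finite A" "finite B" and disj: "A \<inter> B = {}"
    and \<phi>: "\<And>J f. J \<subseteq> A \<Longrightarrow> f \<in> A \<rightarrow>\<^sub>E A \<union> B \<Longrightarrow> {x \<in> A. f x \<in> B} = J \<Longrightarrow>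
            \<phi> f = \<psi> J (restrict f (A - J))"
  shows "sum \<phi> (A \<rightarrow>\<^sub>E A \<union> B) =
         (\<Sum>J\<in>Pow A. of_nat (card B) ^ card J * sum (\<psi> J) ((A - J) \<rightarrow>\<^sub>E (A - J) \<union> J))"
proof -
  let ?S = "A \<rightarrow>\<^sub>E A \<union> B" and ?J = "\<lambda>f. {x \<in> A. f x \<in> B}"
  have "sum \<phi> ?S = (\<Sum>J\<in>Pow A. sum \<phi> {f \<in> ?S. ?J f = J})"
    using fin by (intro sum.group[symmetric] finite_PiE) auto
  also have "\<dots> = (\<Sum>J\<in>Pow A. of_nat (card B) ^ card J * sum (\<psi> J) ((A - J) \<rightarrow>\<^sub>E (A - J) \<union> J))"
  proof (rule sum.cong)
    fix J assume "J \<in> Pow A"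
    then have J: "J \<subseteq> A" "finite J" using fin finite_subset by auto
    have "sum \<phi> {f \<in> ?S. ?J f = J} =
        (\<Sum>(g, h)\<in>(J \<rightarrow>\<^sub>E B) \<times> ((A - J) \<rightarrow>\<^sub>E A). \<psi> J h)"
    proof (rule sum.reindex_bij_witness[where
          i = "\<lambda>(g, h). (\<lambda>x. if x \<in> J then g x else h x)" and
          j = "\<lambda>f. (restrict f J, restrict f (A - J))"], goal_cases)
      case (1 f)
      with J show ?case by (auto simp: fun_eq_iff PiE_def extensional_def)
    next
      case (2 f)
      with J show ?case by (auto simp: PiE_def)
    next
      case (3 gh)
      then show ?case
        by (auto simp: fun_eq_iff PiE_def extensional_def split: prod.splits)
    next
      case (4 gh)
      with J disj show ?case by (auto simp: PiE_iff extensional_def split: if_splits)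
    next
      case (5 f)
      with J \<phi>[of J f] show ?case by auto
    qed
    also have "\<dots> = (\<Sum>g\<in>J \<rightarrow>\<^sub>E B. \<Sum>h\<in>(A - J) \<rightarrow>\<^sub>E A. \<psi> J h)"
      by (rule sum.cartesian_product[symmetric])
    also have "\<dots> = of_nat (card B) ^ card J * sum (\<psi> J) ((A - J) \<rightarrow>\<^sub>E (A - J) \<union> J)"
      using J by (simp add: card_PiE Un_absorb2)
    finally show "sum \<phi> {f \<in> ?S. ?J f = J} = \<dots>" .
  qed simp
  finally show ?thesis .
qed

section \<open>Weighted binomial sums over subsets\<close>

lemma sum_Pow_power:
  fixes x y :: "'a::comm_semiring_1"
  assumes "finite A"
  shows "(\<Sum>J\<in>Pow A. x ^ card J * y ^ card (A - J)) = (x + y) ^ card A"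
  using prod_add[OF assms, of "\<lambda>_. x" "\<lambda>_. y"] by simp

text \<open>The binomial theorem differentiated in \<open>x\<close> and multiplied by
  \<open>x\<close>; the extra factor \<open>x + y\<close> avoids the exponent
  \<open>card A - 1\<close>.\<close>

lemma sum_Pow_card_power:
  fixes x y :: "'a::comm_semiring_1"
  assumes "finite A"
  shows "(x + y) * (\<Sum>J\<in>Pow A. of_nat (card J) * (x ^ card J * y ^ card (A - J))) =
    of_nat (card A) * x * (x + y) ^ card A"
  using assms
proof (induction A)
  case (insert a A)
  let ?w = "\<lambda>A J. of_nat (card J) * (x ^ card J * y ^ card (A - J))"
  have inj: "inj_on (insert a) (Pow A)"
    using insert.hyps by (auto simp: inj_on_def)
  have fin: "finite J" "a \<notin> J" if "J \<in> Pow A" for J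
    using that insert.hyps finite_subset by auto
  have "sum (?w (insert a A)) (Pow (insert a A)) =
      sum (?w (insert a A)) (Pow A) + sum (?w (insert a A)) (insert a ` Pow A)"
    unfolding Pow_insert using insert.hyps by (intro sum.union_disjoint) auto
  also have "sum (?w (insert a A)) (Pow A) = y * sum (?w A) (Pow A)"
    unfolding sum_distrib_left
  proof (rule sum.cong)
    fix J assume "J \<in> Pow A"
    then have "insert a A - J = insert a (A - J)" using fin by auto
    then show "?w (insert a A) J = y * ?w A J"
      using insert.hyps by (simp add: algebra_simps)
  qed simp
  also have "sum (?w (insert a A)) (insert a ` Pow A) =
      (\<Sum>J\<in>Pow A. x * ?w A J + x * (x ^ card J * y ^ card (A - J)))"
    unfolding sum.reindex[OF inj]
  proof (rule sum.cong)
    fix J assume J: "J \<in> Pow A"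
    then have "insert a A - insert a J = A - J" using insert.hyps by auto
    then show "(?w (insert a A) \<circ> insert a) J = x * ?w A J + x * (x ^ card J * y ^ card (A - J))"
      using fin[OF J] by (simp add: algebra_simps)
  qed simp
  also have "\<dots> = x * sum (?w A) (Pow A) + x * (x + y) ^ card A"
    by (simp add: sum.distrib sum_distrib_left[symmetric] sum_Pow_power insert.hyps)
  finally have "(x + y) * sum (?w (insert a A)) (Pow (insert a A)) =
      (x + y) * ((x + y) * sum (?w A) (Pow A)) + (x + y) * (x * (x + y) ^ card A)"
    by (simp add: algebra_simps)
  then show ?case
    unfolding insert.IH using insert.hyps by (simp add: algebra_simps)
qed simp

section \<open>Counting acyclic functions\<close>

text \<open>Witnessed by a rank function, which glues along the decomposition without any iteration of \<open>f\<close>.\<close>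

definition acyclic_fun :: "'a set \<Rightarrow> ('a \<Rightarrow> 'a) \<Rightarrow> bool" where
  "acyclic_fun A f \<longleftrightarrow> (\<exists>h::'a \<Rightarrow> nat. \<forall>x\<in>A. f x \<in> A \<longrightarrow> h (f x) < h x)"

lemma acyclic_fun_split:
  assumes "f \<in> A \<rightarrow>\<^sub>E A \<union> B" "A \<inter> B = {}" "J = {x \<in> A. f x \<in> B}"
  shows "acyclic_fun A f \<longleftrightarrow> acyclic_fun (A - J) (restrict f (A - J))"
proof
  show "acyclic_fun A f \<Longrightarrow> acyclic_fun (A - J) (restrict f (A - J))"
    unfolding acyclic_fun_def by auto
next
  assume "acyclic_fun (A - J) (restrict f (A - J))"
  then obtain h :: "'a \<Rightarrow> nat"
    where h: "\<And>x. x \<in> A - J \<Longrightarrow> f x \<in> A - J \<Longrightarrow> h (f x) < h x"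
    unfolding acyclic_fun_def by auto
  show "acyclic_fun A f"
    unfolding acyclic_fun_def
    \<comment> \<open>Points of \<open>J\<close> leave \<open>A\<close> at once, so rank 0 is safe
      for them; \<open>Suc\<close> lifts all other points above it.\<close>
    by (rule exI[of _ "\<lambda>x. if x \<in> J then 0 else Suc (h x)"])
      (use h assms in auto)
qed

text \<open>In fact equality holds (a form of Cayley's formula).\<close>

lemma acyclic_fun_count:
  assumes "finite A" "finite B" "A \<inter> B = {}"
  shows "real (card B) * real (card A + card B) ^ card A \<le>
    real (card A + card B) * real (card {f \<in> A \<rightarrow>\<^sub>E A \<union> B. acyclic_fun A f})"
  using assms
proof (induction "card A" arbitrary: A B rule: less_induct)
  case less
  let ?N = "\<lambda>A B::'a set. (\<Sum>f\<in>A \<rightarrow>\<^sub>E A \<union> B. of_bool (acyclic_fun A f)) :: real"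
  have N: "real (card {f \<in> A \<rightarrow>\<^sub>E A \<union> B. acyclic_fun A f}) = ?N A B"
    if "finite A" "finite B" for A B :: "'a set"
    using that by (simp add: sum.If_cases of_bool_def finite_PiE Int_def)
  define a b where "a = real (card A)" and "b = real (card B)"
  show ?case
  proof (cases "A = {}")
    case True
    then show ?thesis by (simp add: acyclic_fun_def)
  next
    case False
    then have a: "a > 0" using less.prems by (auto simp: a_def card_gt_0_iff)
    \<comment> \<open>The subproblem \<open>(A - J, J)\<close> has total size \<open>card A\<close>,
      so the induction hypothesis has base \<open>a\<close>. It needs a smaller set, hence nonempty
      \<open>J\<close>; for \<open>J = {}\<close> the left side vanishes.\<close>
    have "of_nat (card J) * (b ^ card J * a ^ card (A - J)) \<le> a * (b ^ card J * ?N (A - J) J)"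
      if "J \<in> Pow A" for J
    proof (cases "J = {}")
      case False
      have fin: "finite J" using that less.prems finite_subset by auto
      have card: "card (A - J) + card J = card A"
        using that fin less.prems by (metis Pow_iff add.commute card_Diff_subset card_mono le_add_diff_inverse)
      then have "card (A - J) < card A" using False fin by (simp add: card_gt_0_iff flip: card)
      from less.hyps[OF this, of J] have "real (card J) * a ^ card (A - J) \<le> a * ?N (A - J) J"
        using less.prems fin N[of "A - J" J] card by (auto simp: a_def)
      from mult_left_mono[OF this, of "b ^ card J"] show ?thesis
        by (simp add: b_def algebra_simps)
    qed (auto intro!: mult_nonneg_nonneg sum_nonneg simp: a_def b_def)
    then have "(\<Sum>J\<in>Pow A. of_nat (card J) * (b ^ card J * a ^ card (A - J))) \<le>
        a * (\<Sum>J\<in>Pow A. b ^ card J * ?N (A - J) J)"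
      unfolding sum_distrib_left by (rule sum_mono)
    also have "(\<Sum>J\<in>Pow A. b ^ card J * ?N (A - J) J) = ?N A B"
      unfolding b_def
    proof (rule sum_PiE_by_preimage[symmetric])
      fix J f assume "f \<in> A \<rightarrow>\<^sub>E A \<union> B" "{x \<in> A. f x \<in> B} = J"
      then show "of_bool (acyclic_fun A f) = (of_bool (acyclic_fun (A - J) (restrict f (A - J))) :: real)"
        using acyclic_fun_split[of f A B J] less.prems by simp
    qed (use less.prems in auto)
    \<comment> \<open>The factor \<open>b + a\<close> brings the left side into the form of
      \<open>sum_Pow_card_power\<close>; the positive factor \<open>a\<close> then cancels.\<close>
    finally have "(b + a) * (\<Sum>J\<in>Pow A. of_nat (card J) * (b ^ card J * a ^ card (A - J))) \<le>
        (b + a) * (a * ?N A B)"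
      by (rule mult_left_mono) (simp add: a_def b_def)
    then have "a * (b * (b + a) ^ card A) \<le> a * ((b + a) * ?N A B)"
      using sum_Pow_card_power[OF less.prems(1), of b a] by (simp add: a_def b_def algebra_simps)
    then have "b * (b + a) ^ card A \<le> (b + a) * ?N A B"
      using a by simp
    then show ?thesis
      using N[OF less.prems(1,2)] by (simp add: a_def b_def algebra_simps)
  qed
qed

section \<open>Exponential moments of the layers\<close>

text \<open>For disjoint \<open>A\<close> and \<open>B\<close>, the points whose \<open>f\<close>-orbit first meets \<open>B\<close> after exactly \<open>t\<close> steps.\<close>

fun layer :: "'a set \<Rightarrow> 'a set \<Rightarrow> ('a \<Rightarrow> 'a) \<Rightarrow> nat \<Rightarrow> 'a set" where
  "layer A B f 0 = B"
| "layer A B f (Suc t) = layer (A - {x \<in> A. f x \<in> B}) {x \<in> A. f x \<in> B} f t"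

lemma layer_cong:
  assumes "\<And>x. x \<in> A \<Longrightarrow> f x = g x"
  shows "layer A B f t = layer A B g t"
  using assms
proof (induction t arbitrary: A B)
  case (Suc t)
  then have "{x \<in> A. f x \<in> B} = {x \<in> A. g x \<in> B}" by auto
  then show ?case
    unfolding layer.simps by (simp only:) (rule Suc.IH, simp add: Suc.prems)
qed simp

text \<open>Take reciprocals in \<open>1 + x \<le> exp x\<close> at
  \<open>x = - 1 / (m + 1)\<close>; the inverse of \<open>m / (m + 1)\<close> is
  \<open>1 + 1 / m\<close>.\<close>

lemma exp_inverse_Suc_le:
  assumes "m > 0"
  shows "exp (1 / real (Suc m)) \<le> 1 + 1 / real m"
proof -
  have "1 - 1 / real (Suc m) \<le> exp (- (1 / real (Suc m)))"
    using exp_ge_add_one_self[of "- (1 / real (Suc m))"] by simp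
  then have "inverse (exp (- (1 / real (Suc m)))) \<le> inverse (1 - 1 / real (Suc m))"
    using assms by (intro le_imp_inverse_le) (auto simp: field_simps)
  also have "\<dots> = 1 + 1 / real m"
    using assms by (simp add: field_simps)
  finally show ?thesis by (simp add: exp_minus)
qed

text \<open>Peeling off the first layer \<open>J\<close> turns \<open>(A, B, m, Suc t)\<close> into
  \<open>(A - J, J, Suc m, t)\<close>. The denominator \<open>m + t\<close> is thereby preserved,
  which is why \<open>m\<close> varies in the induction.\<close>

lemma sum_exp_layer_le:
  assumes "finite A" "finite B" "A \<inter> B = {}" "m > 0"
  shows "(\<Sum>f\<in>A \<rightarrow>\<^sub>E A \<union> B. exp (real (card (layer A B f t)) / real (m + t))) \<le>
    real (card A + card B) ^ card A * exp (real (card B) / real m)"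
  using assms
proof (induction t arbitrary: A B m)
  case 0
  then show ?case by (simp add: card_PiE card_Un_disjoint)
next
  case (Suc t)
  define a b where "a = real (card A)" and "b = real (card B)"
  have ab: "a \<ge> 0" "b \<ge> 0" by (simp_all add: a_def b_def)
  let ?W = "\<lambda>J. \<Sum>h\<in>(A - J) \<rightarrow>\<^sub>E (A - J) \<union> J. exp (real (card (layer (A - J) J h t)) / real (m + Suc t))"
  have "(\<Sum>f\<in>A \<rightarrow>\<^sub>E A \<union> B. exp (real (card (layer A B f (Suc t))) / real (m + Suc t))) =
      (\<Sum>J\<in>Pow A. b ^ card J * ?W J)"
    unfolding b_def
  proof (rule sum_PiE_by_preimage)
    fix J f assume "{x \<in> A. f x \<in> B} = J"
    moreover have "layer (A - J) J f t = layer (A - J) J (restrict f (A - J)) t"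
      by (rule layer_cong) simp
    ultimately show "exp (real (card (layer A B f (Suc t))) / real (m + Suc t)) =
       exp (real (card (layer (A - J) J (restrict f (A - J)) t)) / real (m + Suc t))"
      by simp
  qed (use Suc.prems in auto)
  also have "\<dots> \<le> (\<Sum>J\<in>Pow A. (b * exp (1 / real (Suc m))) ^ card J * a ^ card (A - J))"
  proof (rule sum_mono)
    fix J assume J: "J \<in> Pow A"
    have fin: "finite J" using J Suc.prems finite_subset by auto
    have card: "card (A - J) + card J = card A"
      using J fin Suc.prems by (metis Pow_iff add.commute card_Diff_subset card_mono le_add_diff_inverse)
    have "?W J \<le> a ^ card (A - J) * exp (real (card J) / real (Suc m))"
      using Suc.IH[of "A - J" J "Suc m"] fin Suc.prems card by (simp add: a_def Diff_Int_distrib2)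
    also have "exp (real (card J) / real (Suc m)) = exp (1 / real (Suc m)) ^ card J"
      by (simp add: exp_of_nat_mult[symmetric])
    finally have "b ^ card J * ?W J \<le> b ^ card J * (a ^ card (A - J) * exp (1 / real (Suc m)) ^ card J)"
      using ab by (intro mult_left_mono) auto
    then show "b ^ card J * ?W J \<le> (b * exp (1 / real (Suc m))) ^ card J * a ^ card (A - J)"
      by (simp add: power_mult_distrib algebra_simps)
  qed
  also have "\<dots> = (b * exp (1 / real (Suc m)) + a) ^ card A"
    by (rule sum_Pow_power) (fact Suc.prems)
  \<comment> \<open>The base is at most \<open>(a + b) * (1 + z)\<close> with
    \<open>z = b / m / (a + b)\<close>. By \<open>1 + z \<le> exp z\<close> the power contributes
    \<open>exp (a * z)\<close>, and \<open>a * z \<le> b / m\<close>.\<close>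
  also have "\<dots> \<le> (a + b) ^ card A * exp (b / real m)"
  proof (cases "A = {}")
    case False
    then have a: "a > 0" using Suc.prems by (auto simp: a_def card_gt_0_iff)
    have "b * exp (1 / real (Suc m)) \<le> b * (1 + 1 / real m)"
      using ab exp_inverse_Suc_le[OF Suc.prems(4)] by (intro mult_left_mono) auto
    then have "b * exp (1 / real (Suc m)) + a \<le> (a + b) + b / real m"
      by (simp add: algebra_simps)
    also have "\<dots> = (a + b) * (1 + b / real m / (a + b))"
    proof -
      have "a + b + z = (a + b) * (1 + z / (a + b))" for z
        using a ab by (simp add: field_simps)
      then show ?thesis .
    qed
    also have "\<dots> \<le> (a + b) * exp (b / real m / (a + b))"
      using ab exp_ge_add_one_self[of "b / real m / (a + b)"] by (intro mult_left_mono) auto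
    finally have "(b * exp (1 / real (Suc m)) + a) ^ card A \<le>
        ((a + b) * exp (b / real m / (a + b))) ^ card A"
      using ab by (intro power_mono) auto
    also have "\<dots> = (a + b) ^ card A * exp (a * (b / real m / (a + b)))"
      by (simp add: power_mult_distrib exp_of_nat_mult[symmetric] a_def)
    also have "a * (b / real m / (a + b)) \<le> b / real m"
    proof -
      have "a * (z / (a + b)) \<le> z" if "z \<ge> 0" for z
        using a ab that by (simp add: field_simps)
      from this[of "b / real m"] show ?thesis using ab by simp
    qed
    finally show ?thesis using ab by (simp add: mult_left_mono)
  qed (use ab in simp)
  finally show ?case by (simp add: a_def b_def)
qed

section \<open>Trees and parent functions\<close>

definition parent_graph :: "'a set \<Rightarrow> 'a \<Rightarrow> ('a \<Rightarrow> 'a) \<Rightarrow> 'a pair_pre_digraph" where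
  "parent_graph V r f = \<lparr>pverts = V, parcs = (\<Union>x\<in>V - {r}. {(x, f x), (f x, x)})\<rparr>"

lemma parent_graph_simps [simp]:
  "pverts (parent_graph V r f) = V"
  "parcs (parent_graph V r f) = (\<Union>x\<in>V - {r}. {(x, f x), (f x, x)})"
  by (simp_all add: parent_graph_def)

text \<open>Acyclicity on \<open>V - {r}\<close> says nothing about points sent to \<open>r\<close>;
  giving \<open>r\<close> rank 0 and shifting the other ranks covers these too.\<close>

lemma parent_rank:
  assumes "f \<in> (V - {r}) \<rightarrow> V" "acyclic_fun (V - {r}) f"
  obtains h :: "'a \<Rightarrow> nat" where "\<And>x. x \<in> V - {r} \<Longrightarrow> h (f x) < h x"
proof -
  from assms obtain h :: "'a \<Rightarrow> nat"
    where h: "\<And>x. x \<in> V - {r} \<Longrightarrow> f x \<in> V - {r} \<Longrightarrow> h (f x) < h x"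
    unfolding acyclic_fun_def by auto
  show ?thesis
    by (rule that[of "\<lambda>x. if x = r then 0 else Suc (h x)"]) (use h assms in auto)
qed

lemma pcas_nth:
  "pcas u p v \<Longrightarrow> k < length p \<Longrightarrow>
     p ! k = (pawalk_verts u p ! k, pawalk_verts u p ! Suc k)"
proof (induction p arbitrary: u k)
  case (Cons e p)
  have "pawalk_verts (snd e) p ! 0 = snd e"
    using Cons.prems by (cases p) auto
  with Cons show ?case by (cases k) (auto simp: prod_eq_iff)
qed simp

text \<open>Following \<open>f\<close> lowers the rank until \<open>r\<close> is reached, which
  gives connectedness; the strict drop also excludes loops.\<close>

lemma undirected_tree_parent_graph:
  assumes fin: "finite V" and r: "r \<in> V" and f: "f \<in> (V - {r}) \<rightarrow> V"
    and acyc: "acyclic_fun (V - {r}) f"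
  shows "undirected_tree (parent_graph V r f)"
proof -
  obtain h :: "'a \<Rightarrow> nat" where h: "\<And>x. x \<in> V - {r} \<Longrightarrow> h (f x) < h x"
    using parent_rank[OF f acyc] by blast
  have ne: "f x \<noteq> x" "x \<noteq> f x" if "x \<in> V - {r}" for x
    using h[OF that] by auto
  let ?T = "parent_graph V r f"
  interpret pair_graph ?T
  proof
    show "symmetric (with_proj ?T)"
      by (auto simp: symmetric_def sym_def)
  qed (use fin f ne in auto)
  have to_r: "x \<in> V \<Longrightarrow> x \<rightarrow>\<^sup>*\<^bsub>with_proj ?T\<^esub> r" for x
  proof (induction "h x" arbitrary: x rule: less_induct)
    case less
    show ?case
    proof (cases "x = r")
      case True
      then show ?thesis using r by (simp add: reachable_refl)
    next
      case False
      then have x: "x \<in> V - {r}" using less.prems by simp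
      then have "f x \<in> V" using f by auto
      with h[OF x] have reach: "f x \<rightarrow>\<^sup>*\<^bsub>with_proj ?T\<^esub> r" by (rule less.hyps)
      have "(x, f x) \<in> parcs ?T" using x by auto
      from adj_reachable_trans[OF this reach] show ?thesis .
    qed
  qed
  have "u \<rightarrow>\<^sup>*\<^bsub>with_proj ?T\<^esub> v" if "u \<in> V" "v \<in> V" for u v
    using to_r[OF that(1)] symmetric_reachable[OF pair_sym_arcs to_r[OF that(2)]]
    by (rule reachable_trans)
  then have conn: "Digraph_Component.connected (with_proj ?T)"
    using r reachable_mk_symmetric_eq[OF pair_sym_arcs]
    by (auto simp: Digraph_Component.connected_def strongly_connected_def mk_symmetric_def)
  txt \<open>On a cycle both neighbours of a vertex of maximal rank would be its image under \<open>f\<close>.\<close>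
  have False if c: "cycle p" and l: "length p \<ge> 3" for p
  proof -
    from c obtain u where u: "awalk u p u" "distinct (tl (pawalk_verts u p))"
      by (auto simp: cycle_def)
    \<comment> \<open>The closed walk has vertices \<open>w 0, ..., w n\<close> with
      \<open>w 0 = w n\<close>; its distinct tail is indexed by \<open>{1..n}\<close>.\<close>
    define w where "w = (\<lambda>k. pawalk_verts u p ! k)"
    define n where "n = length p"
    have len: "length (pawalk_verts u p) = Suc n"
      using length_awalk_verts[of u p] by (simp add: n_def)
    have arc: "(w k, w (Suc k)) \<in> parcs ?T" if "k < n" for k
    proof -
      have "p ! k = (w k, w (Suc k))"
        using pcas_nth[of u p u k] u(1) that by (simp add: w_def n_def awalk_def)
      moreover have "p ! k \<in> parcs ?T"
        using u(1) that unfolding awalk_def n_def by (meson nth_mem subsetD)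
      ultimately show ?thesis by simp
    qed
    have "w 0 = hd (pawalk_verts u p)"
      by (simp add: w_def hd_conv_nth)
    moreover have "w n = last (pawalk_verts u p)"
      using len by (simp add: w_def last_conv_nth)
    ultimately have w0: "w 0 = w n"
      using u(1) by simp
    have inj: "i = j" if "w i = w j" "i \<in> {1..n}" "j \<in> {1..n}" for i j
    proof -
      have "tl (pawalk_verts u p) ! (k - 1) = w k" if "k \<in> {1..n}" for k
        using that len by (cases k) (auto simp: nth_tl w_def)
      with that have "tl (pawalk_verts u p) ! (i - 1) = tl (pawalk_verts u p) ! (j - 1)"
        by metis
      then have "i - 1 = j - 1"
        using that len u(2) by (subst (asm) nth_eq_iff_index_eq) auto
      with that show ?thesis by auto
    qed
    obtain i where i: "i \<in> {1..n}" and max: "\<And>j. j \<in> {1..n} \<Longrightarrow> h (w j) \<le> h (w i)"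
    proof -
      have "Max ((\<lambda>i. h (w i)) ` {1..n}) \<in> (\<lambda>i. h (w i)) ` {1..n}"
        using l by (intro Max_in) (auto simp: n_def)
      then obtain i where "i \<in> {1..n}" "Max ((\<lambda>i. h (w i)) ` {1..n}) = h (w i)"
        by auto
      then show ?thesis using that[of i] Max_ge[of "(\<lambda>i. h (w i)) ` {1..n}"] by auto
    qed
    \<comment> \<open>The other kind of arc has \<open>f z = w i\<close>, which would give
      \<open>z\<close> the larger rank.\<close>
    have up: "z = f (w i)" if "(w i, z) \<in> parcs ?T" "h z \<le> h (w i)" for z
    proof -
      from that(1) consider "z = f (w i)" | "z \<in> V - {r}" "w i = f z" by auto
      then show ?thesis
        by cases (use h[of z] that(2) in auto)
    qed
    \<comment> \<open>Cyclic predecessor and successor of \<open>i\<close>, kept inside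
      \<open>{1..n}\<close> where \<open>w\<close> is injective.\<close>
    define a where "a = (if i = 1 then n else i - 1)"
    define b where "b = (if i = n then 1 else Suc i)"
    have ab: "a \<in> {1..n}" "b \<in> {1..n}"
      using i l by (auto simp: a_def b_def n_def)
    have "w a = w (i - 1)" using i w0 by (auto simp: a_def)
    moreover have "i - 1 < n" "Suc (i - 1) = i" using i by auto
    ultimately have "(w a, w i) \<in> parcs ?T" using arc[of "i - 1"] by metis
    then have "(w i, w a) \<in> parcs ?T" by (rule arcs_symmetric)
    moreover have "(w i, w b) \<in> parcs ?T"
    proof (cases "i = n")
      case True
      then have "b = Suc 0" "0 < n" using i by (auto simp: b_def)
      then show ?thesis using arc[of 0] w0 True by metis
    next
      case False
      then have "b = Suc i" "i < n" using i by (auto simp: b_def)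
      then show ?thesis using arc[of i] by metis
    qed
    ultimately have "w a = w b"
      using up[OF _ max[OF ab(1)]] up[OF _ max[OF ab(2)]] by simp
    then have "a = b" using inj ab by blast
    \<comment> \<open>Predecessor and successor coincide only on a closed walk of length at most
      2.\<close>
    then show False using i l by (auto simp: a_def b_def n_def split: if_splits)
  qed
  then show ?thesis
    using conn pair_graph_axioms by (auto simp: undirected_tree_def)
qed

text \<open>Induction on the rank for \<open>f\<close>: if the edge from \<open>x\<close> to
  \<open>f x\<close> came from \<open>g (f x) = x\<close>, agreement at the lower point
  \<open>f x\<close> would give \<open>f (f x) = x\<close>, against the rank drop.\<close>

lemma inj_on_parent_graph:
  "inj_on (parent_graph V r) {f \<in> (V - {r}) \<rightarrow>\<^sub>E V. acyclic_fun (V - {r}) f}"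
proof (rule inj_onI)
  fix f g
  assume f: "f \<in> {f \<in> (V - {r}) \<rightarrow>\<^sub>E V. acyclic_fun (V - {r}) f}"
    and g: "g \<in> {f \<in> (V - {r}) \<rightarrow>\<^sub>E V. acyclic_fun (V - {r}) f}"
    and eq: "parent_graph V r f = parent_graph V r g"
  obtain h :: "'a \<Rightarrow> nat" where h: "\<And>x. x \<in> V - {r} \<Longrightarrow> h (f x) < h x"
    using f by (auto intro: parent_rank[of f V r])
  have "x \<in> V - {r} \<Longrightarrow> f x = g x" for x
  proof (induction "h x" arbitrary: x rule: less_induct)
    case less
    have "(x, f x) \<in> parcs (parent_graph V r g)"
      using less.prems unfolding eq[symmetric] by auto
    then consider "g x = f x" | "f x \<in> V - {r}" "g (f x) = x"
      by auto
    then show ?case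
    proof cases
      case 2
      then have "f (f x) = x" using less.hyps[of "f x"] h[OF less.prems] by simp
      then show ?thesis using h[OF less.prems] h[OF 2(1)] by simp
    qed simp
  qed
  then show "f = g"
    using f g by (auto intro: PiE_ext)
qed

text \<open>Acyclic parent functions rooted at 1 inject into the trees, and
  \<open>acyclic_fun_count\<close> with one root counts them.\<close>

lemma card_labelled_trees_ge:
  assumes "n \<ge> 1"
  shows "real n ^ (n - 1) \<le> real n * real (card (labelled_trees n))"
proof -
  let ?A = "{1..n} - {1}"
  let ?F = "{f \<in> ?A \<rightarrow>\<^sub>E {1..n}. acyclic_fun ?A f}"
  have V: "?A \<union> {1} = {1..n}" using assms by (simp add: insert_absorb)
  have card: "card ?A = n - 1" using assms by (simp add: card_Diff_singleton)
  have "parent_graph {1..n} 1 ` ?F \<subseteq> labelled_trees n"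
  proof (rule image_subsetI)
    fix f assume "f \<in> ?F"
    then have "f \<in> ?A \<rightarrow> {1..n}" "acyclic_fun ?A f" by (simp_all add: PiE_def)
    then have "undirected_tree (parent_graph {1..n} 1 f)"
      using assms by (intro undirected_tree_parent_graph) simp_all
    then show "parent_graph {1..n} 1 f \<in> labelled_trees n"
      unfolding labelled_trees_def by simp
  qed
  then have "card ?F \<le> card (labelled_trees n)"
    by (rule card_inj_on_le[OF inj_on_parent_graph _ finite_labelled_trees])
  moreover have "real n ^ (n - 1) \<le> real n * real (card ?F)"
  proof -
    have "(n - 1) + card {1::nat} = n" using assms by simp
    then show ?thesis using acyclic_fun_count[of ?A "{1}"] unfolding V card by simp
  qed
  moreover have "real n * real (card ?F) \<le> real n * real (card (labelled_trees n))"
    using calculation(1) by (intro mult_left_mono) simp_all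
  ultimately show ?thesis by linarith
qed

section \<open>From trees to parent functions\<close>

text \<open>Distance as a natural number, to allow induction. In a tree every vertex is reachable
  from the root, so \<open>LEAST\<close> is attained there.\<close>

definition depth :: "'a pair_pre_digraph \<Rightarrow> 'a \<Rightarrow> 'a \<Rightarrow> nat" where
  "depth T r x = (LEAST k. \<exists>p. pre_digraph.awalk (with_proj T) r p x \<and> length p = k)"

text \<open>\<open>restrict\<close> places the map in the extensional function space over which the
  moments are summed.\<close>

definition parent :: "'a pair_pre_digraph \<Rightarrow> 'a \<Rightarrow> 'a \<Rightarrow> 'a" where
  "parent T r = restrict (\<lambda>x. SOME y. (x, y) \<in> parcs T \<and> Suc (depth T r y) = depth T r x) (pverts T - {r})"

context
  fixes T :: "'a pair_pre_digraph" and r :: 'a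
  assumes tree: "undirected_tree T" and root: "r \<in> pverts T"
begin

interpretation pair_graph T
  using tree by (simp add: undirected_tree_def)

lemma depth_le: "awalk r p x \<Longrightarrow> depth T r x \<le> length p"
  unfolding depth_def by (rule Least_le) auto

lemma shortest_awalk:
  assumes "x \<in> pverts T"
  obtains p where "awalk r p x" "length p = depth T r x"
proof -
  have "r \<rightarrow>\<^sup>*\<^bsub>with_proj T\<^esub> x"
    using tree assms root reachable_mk_symmetric_eq[OF pair_sym_arcs]
    by (auto simp: undirected_tree_def Digraph_Component.connected_def strongly_connected_def
        mk_symmetric_def)
  then obtain p where "awalk r p x" by (auto simp: reachable_awalk)
  then have "\<exists>k p. awalk r p x \<and> length p = k" by blast
  from LeastI_ex[OF this] that show ?thesis unfolding depth_def by blast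
qed

lemma graph_dist_eq_depth:
  assumes "x \<in> pverts T"
  shows "graph_dist T r x = ereal (real (depth T r x))"
proof -
  obtain p where p: "awalk r p x" "length p = depth T r x"
    by (rule shortest_awalk[OF assms])
  have cost: "awalk_cost (\<lambda>_. 1) q = real (length q)" for q
    by (induction q) auto
  show ?thesis
    unfolding graph_dist_def \<mu>_def cost
  proof (rule antisym)
    show "(INF q\<in>{q. awalk r q x}. ereal (real (length q))) \<le> ereal (real (depth T r x))"
      by (rule INF_lower2[of p]) (use p in auto)
    show "ereal (real (depth T r x)) \<le> (INF q\<in>{q. awalk r q x}. ereal (real (length q)))"
      by (rule INF_greatest) (auto dest: depth_le)
  qed
qed

lemma depth_eq_0_iff:
  assumes "x \<in> pverts T"
  shows "depth T r x = 0 \<longleftrightarrow> x = r"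
proof
  assume "depth T r x = 0"
  then obtain p where "awalk r p x" "p = []"
    using shortest_awalk[OF assms] by auto
  then show "x = r" by (simp add: awalk_Nil_iff)
next
  assume "x = r"
  then show "depth T r x = 0"
    using depth_le[of "[]" x] root by (simp add: awalk_Nil_iff)
qed

lemma depth_arc_le:
  assumes "(x, y) \<in> parcs T"
  shows "depth T r y \<le> Suc (depth T r x)"
proof -
  obtain p where "awalk r p x" "length p = depth T r x"
    using shortest_awalk in_arcsD1[OF assms] by blast
  moreover have "awalk x [(x, y)] y"
    using assms by (simp add: awalk_simps in_arcsD1 in_arcsD2)
  ultimately show ?thesis
    using depth_le[of "p @ [(x, y)]" y] awalk_appendI by fastforce
qed

text \<open>The choice is possible: the penultimate vertex of a shortest walk has depth bounded
  above by the shortened walk and below by \<open>depth_arc_le\<close>.\<close>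

lemma parent:
  assumes "x \<in> pverts T - {r}"
  shows "(x, parent T r x) \<in> parcs T" and "Suc (depth T r (parent T r x)) = depth T r x"
proof -
  obtain p where p: "awalk r p x" "length p = depth T r x"
    using shortest_awalk assms by blast
  moreover have "depth T r x \<noteq> 0" using depth_eq_0_iff assms by simp
  ultimately obtain q e where "p = q @ [e]" by (cases p rule: rev_cases) auto
  with p obtain y where q: "awalk r q y" "(y, x) \<in> parcs T" "Suc (length q) = depth T r x"
    by (cases e) (auto simp: awalk_simps)
  then have "Suc (depth T r y) = depth T r x"
    using depth_le[OF q(1)] depth_arc_le[OF q(2)] by simp
  then have "\<exists>y. (x, y) \<in> parcs T \<and> Suc (depth T r y) = depth T r x"
    using q(2) arcs_symmetric by blast
  from someI_ex[OF this] show "(x, parent T r x) \<in> parcs T"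
    and "Suc (depth T r (parent T r x)) = depth T r x"
    using assms by (simp_all add: parent_def)
qed

lemma parent_PiE: "parent T r \<in> (pverts T - {r}) \<rightarrow>\<^sub>E pverts T"
proof (rule PiE_I)
  show "parent T r x \<in> pverts T" if "x \<in> pverts T - {r}" for x
    using parent(1)[OF that] by (rule in_arcsD2)
qed (auto simp: parent_def)

lemma arc_imp_parent:
  assumes arc: "(x, y) \<in> parcs T"
  shows "x \<noteq> r \<and> y = parent T r x \<or> y \<noteq> r \<and> x = parent T r y"
proof (rule ccontr)
  assume not_parent: "\<not> ?thesis"
  txt \<open>The parent arcs still connect \<open>x\<close> with \<open>y\<close> when this edge is removed; it closes a cycle.\<close>
  define E where "E = parcs T - {(x, y), (y, x)}"
  have to_root: "z \<in> pverts T \<Longrightarrow> \<exists>p. awalk z p r \<and> set p \<subseteq> E" for z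
  proof (induction "depth T r z" arbitrary: z rule: less_induct)
    case less
    show ?case
    proof (cases "z = r")
      case True
      then show ?thesis using root by (intro exI[of _ "[]"]) (simp add: awalk_Nil_iff)
    next
      case False
      then have z: "z \<in> pverts T - {r}" using less.prems by simp
      note p = parent[OF z]
      obtain q where q: "awalk (parent T r z) q r" "set q \<subseteq> E"
        using less.hyps[of "parent T r z"] p(2) in_arcsD2[OF p(1)] by auto
      have "(z, parent T r z) \<in> E"
        using p(1) False not_parent by (auto simp: E_def)
      with q p(1) less.prems show ?thesis
        by (intro exI[of _ "(z, parent T r z) # q"]) (simp add: awalk_Cons_iff)
    qed
  qed
  obtain p where p: "awalk x p r" "set p \<subseteq> E"
    using to_root in_arcsD1[OF arc] by blast
  obtain q where q: "awalk y q r" "set q \<subseteq> E"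
    using to_root in_arcsD2[OF arc] by blast
  \<comment> \<open>\<open>E\<close> omits both orientations of the edge, so it is closed under
    reversal.\<close>
  have "set (rev_path q) = prod.swap ` set q"
    by (induction q) auto
  moreover have "prod.swap ` E \<subseteq> E"
    unfolding E_def using arcs_symmetric by auto
  ultimately have "set (rev_path q) \<subseteq> E" using q(2) by blast
  moreover have w: "awalk x (p @ rev_path q) y"
    using p(1) q(1) by (intro awalk_appendI) auto
  define a where "a = awalk_to_apath (p @ rev_path q)"
  ultimately have a: "apath x a y" "set a \<subseteq> E"
    using awalk_to_apath_subset[OF w] apath_awalk_to_apath[OF w] p(2) by (auto simp: a_def)
  have "x \<noteq> y" using arc no_loops' by blast
  \<comment> \<open>The path is nonempty as \<open>x \<noteq> y\<close>, and a single arc would be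
    \<open>(x, y)\<close>, which is not in \<open>E\<close>. Adding the closing arc gives length at
    least 3.\<close>
  have "length a \<ge> 2"
  proof (rule ccontr)
    assume "\<not> length a \<ge> 2"
    then consider "a = []" | e where "a = [e]"
      by (cases a; cases "tl a") auto
    then show False
      using a \<open>x \<noteq> y\<close> by cases (auto simp: apath_simps E_def)
  qed
  moreover have "cycle (a @ [(y, x)])"
  proof -
    have "awalk y [(y, x)] x"
      using arc by (simp add: awalk_simps arcs_symmetric in_arcsD1 in_arcsD2)
    with a(1) have "awalk x (a @ [(y, x)]) x"
      by (auto simp: apath_def intro: awalk_appendI)
    moreover have "pawalk_verts x (a @ [(y, x)]) = pawalk_verts x a @ [x]"
      using awalk_verts_append[OF calculation] a(1) by (simp add: apath_def)
    moreover have "pawalk_verts x a = x # tl (pawalk_verts x a)"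
      using a(1) by (cases a) (auto simp: apath_simps)
    \<comment> \<open>This tail is a rotation of the distinct vertex list of the path.\<close>
    then have "distinct (tl (pawalk_verts x a @ [x]))"
      using a(1) unfolding apath_def
      by (metis append_Cons distinct.simps(2) distinct1_rotate list.sel(3) rotate1.simps(2))
    ultimately show ?thesis unfolding cycle_def by auto
  qed
  moreover have "\<not> (\<exists>p. cycle p \<and> length p \<ge> 3)"
    using tree by (simp add: undirected_tree_def)
  ultimately show False
    by (metis One_nat_def Suc_eq_plus1 Suc_le_mono length_append_singleton numeral_2_eq_2 numeral_3_eq_3)
qed

text \<open>Recovering the tree makes \<open>parent\<close> injective on trees with fixed vertex set
  and root.\<close>

lemma parent_graph_parent: "parent_graph (pverts T) r (parent T r) = T"
proof -
  have "(\<Union>x\<in>pverts T - {r}. {(x, parent T r x), (parent T r x, x)}) = parcs T"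
    (is "?E = _")
  proof
    show "?E \<subseteq> parcs T" using parent(1) arcs_symmetric by blast
    show "parcs T \<subseteq> ?E"
    proof (rule subrelI)
      fix x y assume xy: "(x, y) \<in> parcs T"
      from arc_imp_parent[OF xy] in_arcsD1[OF xy] in_arcsD2[OF xy] show "(x, y) \<in> ?E" by blast
    qed
  qed
  then show ?thesis by (cases T) (simp add: parent_graph_def)
qed

lemma layer_parent:
  "layer (pverts T - {r}) {r} (parent T r) d = {x \<in> pverts T. graph_dist T r x = ereal (real d)}"
proof -
  \<comment> \<open>Generalised to start at depth \<open>k\<close>, since each step of
    \<open>layer\<close> takes the next sphere as root set.\<close>
  have "layer {x \<in> pverts T. depth T r x > k} {x \<in> pverts T. depth T r x = k} (parent T r) d =
      {x \<in> pverts T. depth T r x = k + d}" for k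
  proof (induction d arbitrary: k)
    case (Suc d)
    have "parent T r x \<in> pverts T \<and> Suc (depth T r (parent T r x)) = depth T r x"
      if "x \<in> pverts T" "depth T r x > k" for x
      using parent[of x] depth_eq_0_iff[of x] that in_arcsD2 by auto
    then have "{x \<in> {x \<in> pverts T. k < depth T r x}. parent T r x \<in> {x \<in> pverts T. depth T r x = k}} =
        {x \<in> pverts T. depth T r x = Suc k}" (is "?J = _")
      by fastforce
    moreover have "{x \<in> pverts T. k < depth T r x} - {x \<in> pverts T. depth T r x = Suc k} =
        {x \<in> pverts T. Suc k < depth T r x}" by auto
    ultimately show ?case using Suc.IH[of "Suc k"] by simp
  qed simp
  from this[of 0] have "layer {x \<in> pverts T. depth T r x > 0} {x \<in> pverts T. depth T r x = 0} (parent T r) d =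
      {x \<in> pverts T. depth T r x = d}" by simp
  moreover have "depth T r x > 0 \<longleftrightarrow> x \<noteq> r" if "x \<in> pverts T" for x
    using depth_eq_0_iff[OF that] by (metis neq0_conv)
  then have "{x \<in> pverts T. depth T r x > 0} = pverts T - {r}"
    by blast
  moreover have "{x \<in> pverts T. depth T r x = 0} = {r}"
    using root by (auto simp: depth_eq_0_iff)
  moreover have "{x \<in> pverts T. depth T r x = d} =
      {x \<in> pverts T. graph_dist T r x = ereal (real d)}"
    by (intro Collect_cong) (auto simp: graph_dist_eq_depth)
  ultimately show ?thesis by (simp only:)
qed

end

section \<open>Tail bounds\<close>

text \<open>Markov's inequality in counting form, after embedding the trees into all
  functions.\<close>

lemma card_trees_sphere_le:
  assumes "r \<in> {1..n}"
  shows "real (card {T \<in> labelled_trees n.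
      K * real (Suc d) \<le> real (card {x \<in> pverts T. graph_dist T r x = ereal (real d)})})
    \<le> real n ^ (n - 1) * exp (1 - K)"
proof -
  let ?Z = "\<lambda>f. card (layer ({1..n} - {r}) {r} f d)"
  let ?F = "({1..n} - {r}) \<rightarrow>\<^sub>E {1..n}"
  let ?S = "{T \<in> labelled_trees n.
      K * real (Suc d) \<le> real (card {x \<in> pverts T. graph_dist T r x = ereal (real d)})}"
  let ?G = "{f \<in> ?F. K * real (Suc d) \<le> real (?Z f)}"
  have V: "({1..n} - {r}) \<union> {r} = {1..n}" using assms by (simp add: insert_absorb)
  have card: "card ({1..n} - {r}) = n - 1" using assms by (simp add: card_Diff_singleton)
  have fin: "finite ?F" by (intro finite_PiE) auto
  have tree: "undirected_tree T" "r \<in> pverts T" "pverts T = {1..n}" if "T \<in> labelled_trees n" for T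
    using that assms by (auto simp: labelled_trees_def)
  have "inj_on (\<lambda>T. parent T r) (labelled_trees n)"
  proof (rule inj_onI)
    fix T U assume T: "T \<in> labelled_trees n" and U: "U \<in> labelled_trees n"
      and eq: "parent T r = parent U r"
    have "T = parent_graph {1..n} r (parent T r)"
      using parent_graph_parent[OF tree(1,2)[OF T]] tree(3)[OF T] by simp
    also have "\<dots> = U"
      unfolding eq using parent_graph_parent[OF tree(1,2)[OF U]] tree(3)[OF U] by simp
    finally show "T = U" .
  qed
  then have "inj_on (\<lambda>T. parent T r) ?S" by (rule inj_on_subset) auto
  moreover have "(\<lambda>T. parent T r) ` ?S \<subseteq> ?G"
  proof (rule image_subsetI)
    fix T assume T: "T \<in> ?S"
    then have t: "undirected_tree T" "r \<in> pverts T" "pverts T = {1..n}" using tree by auto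
    have "parent T r \<in> ?F"
      using parent_PiE[OF t(1,2)] unfolding t(3) .
    moreover have "layer ({1..n} - {r}) {r} (parent T r) d =
        {x \<in> pverts T. graph_dist T r x = ereal (real d)}"
      using layer_parent[OF t(1,2), of d] unfolding t(3) .
    ultimately show "parent T r \<in> ?G" using T by (simp only: mem_Collect_eq)
  qed
  moreover have "finite ?G" using fin by (rule finite_subset[rotated]) auto
  ultimately have "card ?S \<le> card ?G"
    by (rule card_inj_on_le)
  then have "real (card ?S) * exp K \<le> real (card ?G) * exp K"
    by (intro mult_right_mono) simp_all
  also have "\<dots> = (\<Sum>f\<in>?G. exp K)" by simp
  also have "\<dots> \<le> (\<Sum>f\<in>?G. exp (real (?Z f) / real (1 + d)))"
  proof (rule sum_mono)
    fix f assume "f \<in> ?G"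
    then have "K * real (1 + d) \<le> real (?Z f)" by simp
    then show "exp K \<le> exp (real (?Z f) / real (1 + d))"
      by (simp add: pos_le_divide_eq)
  qed
  also have "\<dots> \<le> (\<Sum>f\<in>?F. exp (real (?Z f) / real (1 + d)))"
    using fin by (intro sum_mono2) auto
  also have "\<dots> \<le> real n ^ (n - 1) * exp 1"
  proof -
    have "(n - 1) + card {r} = n" using assms by auto
    then show ?thesis
      \<comment> \<open>With \<open>m = 1\<close> and a single root the moment bound is
        \<open>exp 1\<close>, and the denominator is \<open>Suc d\<close>.\<close>
      using sum_exp_layer_le[of "{1..n} - {r}" "{r}" 1 d] unfolding V card by simp
  qed
  finally show ?thesis by (simp add: exp_diff pos_le_divide_eq)
qed

section \<open>Union bound and limit\<close>

lemma beta_ge_imp: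
  assumes "pverts T = {1..n}" "n \<ge> 1" "K \<le> beta T"
  shows "\<exists>r\<in>{1..n}. \<exists>d\<in>{1..n}.
    K * real d \<le> real (card {x \<in> pverts T. graph_dist T r x = ereal (real d)})"
proof -
  let ?q = "\<lambda>(i, d). real (card {j \<in> pverts T. graph_dist T i j = ereal (real d)}) / real d"
  have "{q i d | i d. i \<in> I \<and> d \<in> D} = (\<lambda>(i, d). q i d) ` (I \<times> D)"
    for q :: "nat \<Rightarrow> nat \<Rightarrow> real" and I D by force
  from this[of "\<lambda>i d. real (card {j \<in> pverts T. graph_dist T i j = ereal (real d)}) / real d"
      "{1..n}" "{1..n}"]
  have "beta T = Max (?q ` ({1..n} \<times> {1..n}))"
    unfolding beta_def by (simp add: assms(1))
  also have "\<dots> \<in> ?q ` ({1..n} \<times> {1..n})"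
    using assms(2) by (intro Max_in) auto
  finally show ?thesis
    using assms(3) by (fastforce simp: pos_le_divide_eq)
qed

text \<open>Two factors \<open>n\<close> come from the union over \<open>r\<close> and
  \<open>d\<close>, the third from comparing functions with trees.\<close>

lemma prob_beta_ge_le:
  assumes "n \<ge> 1" "K \<ge> 0"
  shows "measure_pmf.prob (pmf_of_set (labelled_trees n)) {T. K \<le> beta T} \<le>
    real n ^ 3 * exp (1 - K / 2)"
proof -
  let ?S = "\<lambda>r d. {T \<in> labelled_trees n.
      K / 2 * real (Suc d) \<le> real (card {x \<in> pverts T. graph_dist T r x = ereal (real d)})}"
  let ?I = "{1..n} \<times> {1..n}"
  have "labelled_trees n \<inter> {T. K \<le> beta T} \<subseteq> (\<Union>(r, d)\<in>?I. ?S r d)"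
  proof
    fix T assume T: "T \<in> labelled_trees n \<inter> {T. K \<le> beta T}"
    then obtain r d where rd: "(r, d) \<in> ?I" and
      le: "K * real d \<le> real (card {x \<in> pverts T. graph_dist T r x = ereal (real d)})"
      using beta_ge_imp[of T n K] assms by (auto simp: labelled_trees_def)
    \<comment> \<open>Halving \<open>K\<close> pays for passing from \<open>d\<close> to
      \<open>Suc d\<close>, as \<open>Suc d \<le> 2 * d\<close> for
      \<open>d \<ge> 1\<close>.\<close>
    have "K / 2 * real (Suc d) \<le> K / 2 * (2 * real d)"
      using rd assms by (intro mult_left_mono) auto
    with le T rd show "T \<in> (\<Union>(r, d)\<in>?I. ?S r d)" by fastforce
  qed
  then have "card (labelled_trees n \<inter> {T. K \<le> beta T}) \<le> card (\<Union>(r, d)\<in>?I. ?S r d)"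
    using finite_labelled_trees by (intro card_mono) auto
  also have "\<dots> \<le> (\<Sum>(r, d)\<in>?I. card (?S r d))"
    using card_UN_le[of ?I "\<lambda>(r, d). ?S r d"] by (simp add: split_def)
  also have "real \<dots> \<le> (\<Sum>(r, d)\<in>?I. real n ^ (n - 1) * exp (1 - K / 2))"
    unfolding of_nat_sum split_def by (intro sum_mono card_trees_sphere_le) auto
  also have "\<dots> = real n ^ 2 * real n ^ (n - 1) * exp (1 - K / 2)"
    by (simp add: power2_eq_square)
  also have "\<dots> \<le> real n ^ 2 * (real n * real (card (labelled_trees n))) * exp (1 - K / 2)"
    using card_labelled_trees_ge[OF assms(1)] by (intro mult_right_mono mult_left_mono) auto
  finally have "real (card (labelled_trees n \<inter> {T. K \<le> beta T})) \<le>
      (real n ^ 3 * exp (1 - K / 2)) * real (card (labelled_trees n))"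
    by (simp add: power2_eq_square power3_eq_cube algebra_simps)
  moreover have "card (labelled_trees n) > 0"
    using finite_labelled_trees labelled_trees_nonempty[OF assms(1)] by (simp add: card_gt_0_iff)
  ultimately show ?thesis
    using finite_labelled_trees labelled_trees_nonempty[OF assms(1)]
    by (simp add: measure_pmf_of_set pos_divide_le_eq)
qed

theorem theorem1p4:
  fixes c :: real
  shows "(\<lambda>n::nat. real n powr c *
           measure_pmf.prob (pmf_of_set (labelled_trees n)) {T. beta T \<ge> ln (real n) ^ 4})
         \<longlonglongrightarrow> 0"
proof (rule tendsto_sandwich[OF _ _ tendsto_const])
  show "eventually (\<lambda>n. 0 \<le> real n powr c *
      measure_pmf.prob (pmf_of_set (labelled_trees n)) {T. beta T \<ge> ln (real n) ^ 4}) sequentially"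
    by simp
  show "eventually (\<lambda>n. real n powr c *
      measure_pmf.prob (pmf_of_set (labelled_trees n)) {T. beta T \<ge> ln (real n) ^ 4}
      \<le> real n powr c * (real n ^ 3 * exp (1 - ln (real n) ^ 4 / 2))) sequentially"
    using eventually_ge_at_top[of 1]
    by eventually_elim (intro mult_left_mono prob_beta_ge_le, auto)
  show "(\<lambda>n. real n powr c * (real n ^ 3 * exp (1 - ln (real n) ^ 4 / 2))) \<longlonglongrightarrow> 0"
  proof -
    \<comment> \<open>With \<open>x = ln n\<close> the bound is the exponential of a polynomial
      whose leading term is \<open>- x ^ 4 / 2\<close>.\<close>
    have "((\<lambda>x::real. exp ((c + 3) * x + 1 - x ^ 4 / 2)) \<longlongrightarrow> 0) at_top"
      by real_asymp
    moreover have "filterlim (\<lambda>n. ln (real n)) at_top sequentially"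
      by real_asymp
    ultimately have "(\<lambda>n. exp ((c + 3) * ln (real n) + 1 - ln (real n) ^ 4 / 2)) \<longlonglongrightarrow> 0"
      by (rule filterlim_compose)
    moreover have "eventually (\<lambda>n. exp ((c + 3) * ln (real n) + 1 - ln (real n) ^ 4 / 2) =
       real n powr c * (real n ^ 3 * exp (1 - ln (real n) ^ 4 / 2))) sequentially"
      using eventually_ge_at_top[of 1]
    proof eventually_elim
      case (elim n)
      have "real n powr c * (real n ^ 3 * exp (1 - ln (real n) ^ 4 / 2)) =
        real n powr (c + 3) * exp (1 - ln (real n) ^ 4 / 2)"
        using elim by (simp add: powr_add powr_realpow[of _ 3, simplified])
      also have "\<dots> = exp ((c + 3) * ln (real n) + 1 - ln (real n) ^ 4 / 2)"
        using elim by (simp add: powr_def exp_add[symmetric] add_diff_eq)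
      finally show ?case by simp
    qed
    ultimately show ?thesis by (rule Lim_transform_eventually)
  qed
qed

end
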